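(* Let $X$ and $Y$ be normed spaces and let $T,S\in LR(X,Y)$ satisfy $\overline{D(T)}\subset D(S)$ and $S(0)\subset T(0)$. If $S$ is bounded, then $T+S$ is closed (closable) if and only if $T$ is closed (closable). Moreover, $D(\overline{T+S})=D(\overline T)$.
   Context: All spaces are over the same scalar field ($\mathbf R$ or $\mathbf C$). $LR(X,Y)$ is the set of all linear subspaces of $X\times Y$. For $T,S\in LR(X,Y)$: $D(T)$ is the domain of $T$, $T(x)=\{y\in Y:(x,y)\in T\}$, and $T+S=\{(x,y+z):(x,y)\in T,\ (x,z)\in S\}$. $\overline T$ is the closure of $T$ in $X\times Y$; $T$ is closed if $\overline T=T$, and closable if $\overline T(x)=T(x)$ for each $x\in D(T)$. For $x\in D(S)$, $\|S(x)\|:=\|[y]\|$ for any $y\in S(x)$, where $[y]=y+\overline{S(0)}\in Y/\overline{S(0)}$ and $\|[y]\|=\inf\{\|y-e\|:e\in\overline{S(0)}\}$. $\|S\|:=\sup\{\|S(x)\|:x\in D(S),\ \|x\|\le1\}$, and $S$ is bounded if $\|S\|<\infty$. *)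

theory Defs
  imports "HOL-Analysis.Analysis"
begin

text \<open>
  A normed space over the scalar field \<open>'k\<close> is a type of class
  \<^class>\<open>real_normed_vector\<close>, which provides the addition, the norm and the norm topology, together
  with an explicit \<open>'k\<close>-scaling. The class \<^class>\<open>real_normed_field\<close> requires a multiplicative norm,
  so by the Gelfand--Mazur theorem its instances are, up to isometric isomorphism, exactly
  \<open>\<real>\<close> and \<open>\<complex>\<close>.
\<close>

locale normed_space = vector_space scale
  for scale :: "'k::real_normed_field \<Rightarrow> 'x::real_normed_vector \<Rightarrow> 'x" +
  assumes norm_scale: "norm (scale a x) = norm a * norm x"

lemma normed_space_scaleR:
  "normed_space (scaleR :: real \<Rightarrow> 'x::real_normed_vector \<Rightarrow> 'x)"
  by unfold_locales (auto simp: algebra_simps)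

lemma normed_space_times: "normed_space ((*) :: 'k::real_normed_field \<Rightarrow> 'k \<Rightarrow> 'k)"
  by unfold_locales (auto simp: algebra_simps norm_mult)

text \<open>
  The domain \<open>D(T)\<close> of a linear relation is \<^term>\<open>Domain T\<close>, and \<open>T(x)\<close> is \<^term>\<open>T `` {x}\<close>.
  The library's norm on a product type is the Euclidean one; it induces the product topology.
\<close>

definition LR ::
  "('k::real_normed_field \<Rightarrow> 'x::real_normed_vector \<Rightarrow> 'x) \<Rightarrow>
   ('k \<Rightarrow> 'y::real_normed_vector \<Rightarrow> 'y) \<Rightarrow> ('x \<times> 'y) set set"
  where "LR sX sY = {T. module.subspace (module_prod.scale sX sY) T}"

definition lr_add :: "('x \<times> 'y::plus) set \<Rightarrow> ('x \<times> 'y) set \<Rightarrow> ('x \<times> 'y) set"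
  where "lr_add T S = {(x, y + z) | x y z. (x, y) \<in> T \<and> (x, z) \<in> S}"

definition lr_closable :: "('x::topological_space \<times> 'y::topological_space) set \<Rightarrow> bool"
  where "lr_closable T \<longleftrightarrow> (\<forall>x \<in> Domain T. closure T `` {x} = T `` {x})"

text \<open>The norm of the coset \<open>[y] = y + E\<close> in the quotient by a closed subspace \<open>E\<close>.\<close>

definition coset_norm :: "'y::real_normed_vector set \<Rightarrow> 'y \<Rightarrow> real"
  where "coset_norm E y = (INF e\<in>E. norm (y - e))"

definition lr_norm_at ::
  "('x::real_normed_vector \<times> 'y::real_normed_vector) set \<Rightarrow> 'x \<Rightarrow> real"
  where "lr_norm_at S x = coset_norm (closure (S `` {0})) (SOME y. y \<in> S `` {x})"

lemma lr_norm_at_eq: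
  assumes X: "normed_space sX" and Y: "normed_space sY" and S: "S \<in> LR sX sY"
    and y: "y \<in> S `` {x}"
  shows "lr_norm_at S x = coset_norm (closure (S `` {0})) y"
proof -
  interpret X: normed_space sX by fact
  interpret Y: normed_space sY by fact
  interpret P: vector_space_prod sX sY by unfold_locales
  let ?E = "closure (S `` {0})"
  have sub: "P.p.subspace S" using S by (simp add: LR_def)
  define y' where "y' = (SOME y. y \<in> S `` {x})"
  have y': "y' \<in> S `` {x}" unfolding y'_def using y by (rule someI)
  define d where "d = y' - y"
  have d: "(0, d) \<in> S"
    using P.p.subspace_diff[OF sub, of "(x, y')" "(x, y)"] y y' by (simp add: d_def)
  have "(+) d ` (S `` {0}) = S `` {0}"
  proof
    show "(+) d ` (S `` {0}) \<subseteq> S `` {0}"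
      using P.p.subspace_add[OF sub d] by fastforce
    show "S `` {0} \<subseteq> (+) d ` (S `` {0})"
    proof
      fix v assume "v \<in> S `` {0}"
      then have "v - d \<in> S `` {0}"
        using P.p.subspace_diff[OF sub _ d, of "(0, v)"] by simp
      then show "v \<in> (+) d ` (S `` {0})" by (intro image_eqI[of _ _ "v - d"]) simp_all
    qed
  qed
  then have E: "(+) d ` ?E = ?E" by (metis closure_translation)
  have "coset_norm ?E y' = (INF e\<in>(+) d ` ?E. norm (y' - e))"
    unfolding coset_norm_def E ..
  also have "\<dots> = coset_norm ?E y"
    unfolding coset_norm_def image_image by (simp add: d_def algebra_simps)
  finally show ?thesis by (simp add: lr_norm_at_def y'_def)
qed

definition lr_norm :: "('x::real_normed_vector \<times> 'y::real_normed_vector) set \<Rightarrow> ennreal"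
  where "lr_norm S = (SUP x\<in>{x \<in> Domain S. norm x \<le> 1}. ennreal (lr_norm_at S x))"

definition lr_bounded :: "('x::real_normed_vector \<times> 'y::real_normed_vector) set \<Rightarrow> bool"
  where "lr_bounded S \<longleftrightarrow> lr_norm S < \<infinity>"

end

theory Submission
  imports Defs
begin

text \<open>
  Everything follows from the identity \<open>closure (T + S) = closure T + S\<close>, the sum being
  \<^const>\<open>lr_add\<close>.

  A bounded linear relation is a multivalued version of a continuous map: a domain point near
  \<open>0\<close> has some image near \<open>0\<close>. Let \<open>(x, z) \<in> S\<close> and let \<open>(a n, b n) \<in> T\<close> converge to
  \<open>(x, y)\<close>. Then \<open>x - a n\<close> has images \<open>w n\<close> under \<open>S\<close> with \<open>w n \<longlonglongrightarrow> 0\<close>, so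
  \<open>(a n, b n + (z - w n)) \<in> T + S\<close> converges to \<open>(x, y + z)\<close>. Hence
  \<open>closure T + S \<subseteq> closure (T + S)\<close>.

  The reverse inclusion is the same one for the pair \<open>T + S\<close>, \<open>-S\<close>: a point \<open>(x, u)\<close> of
  \<open>closure (T + S)\<close> has \<open>x \<in> closure (Domain T) \<subseteq> Domain S\<close>, so an image \<open>z\<close> of \<open>x\<close> under \<open>S\<close>
  exists and can be subtracted, leaving \<open>(x, u - z) \<in> closure T\<close>. The exchanged pair
  satisfies all the hypotheses again, and \<open>(T + S) + (-S) = T + S(0)\<close> is \<open>T\<close> because
  \<open>S(0) \<subseteq> T(0)\<close>. The same exchange of roles reduces each equivalence of the theorem to
  a single implication, from \<open>T\<close> to \<open>T + S\<close>.

  The images \<open>w n\<close> come from \<open>lr_bounded_image_bound\<close>, which turns the finite relation norm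
  into a Lipschitz-type bound at \<open>0\<close>; the identity itself is \<open>closure_lr_add\<close>.
\<close>

section \<open>Small images under a bounded relation\<close>

text \<open>
  The constant is \<open>\<parallel>S\<parallel> + 1\<close>. The room between it and \<open>\<parallel>S\<parallel>\<close> is needed because the quotient norm
  is an infimum that need not be attained, and because it is taken over the closure of \<open>S(0)\<close>
  whereas only elements of \<open>S(0)\<close> itself may be subtracted from an image. Rescaling to the
  unit sphere then gives a bound that vanishes at \<open>0\<close>.
\<close>

lemma lr_bounded_image_bound:
  fixes sX :: "'k::real_normed_field \<Rightarrow> 'x::real_normed_vector \<Rightarrow> 'x"
    and sY :: "'k \<Rightarrow> 'y::real_normed_vector \<Rightarrow> 'y"
  assumes "normed_space sX" and "normed_space sY"
    and S: "S \<in> LR sX sY" and bdd: "lr_bounded S"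
  obtains C where "\<And>x. x \<in> Domain S \<Longrightarrow> \<exists>w. (x, w) \<in> S \<and> norm w \<le> C * norm x"
proof -
  interpret X: normed_space sX by fact
  interpret Y: normed_space sY by fact
  interpret P: vector_space_prod sX sY by unfold_locales
  have sub: "P.p.subspace S" using S by (simp add: LR_def)
  define K where "K = enn2real (lr_norm S)"
  have unit: "\<exists>w. (u, w) \<in> S \<and> norm w < K + 1" if u: "u \<in> Domain S" "norm u \<le> 1" for u
  proof -
    obtain y where y: "(u, y) \<in> S" using u by blast
    have "ennreal (lr_norm_at S u) \<le> lr_norm S"
      unfolding lr_norm_def using u by (intro SUP_upper) simp
    moreover have "lr_norm S < top" using bdd by (simp add: lr_bounded_def)
    ultimately have "enn2real (ennreal (lr_norm_at S u)) \<le> K"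
      unfolding K_def by (rule enn2real_mono)
    then have "lr_norm_at S u < K + 1"
      by (cases "lr_norm_at S u \<ge> 0") (auto simp: K_def intro: less_le_trans[of _ 0])
    then have "coset_norm (closure (S `` {0})) y < K + 1"
      using lr_norm_at_eq[OF assms(1-3), of y u] y by simp
    moreover have "(0, 0) \<in> S" using P.p.subspace_0[OF sub] by (simp add: zero_prod_def)
    then have "closure (S `` {0}) \<noteq> {}" by auto
    ultimately obtain e where e: "e \<in> closure (S `` {0})" "norm (y - e) < K + 1"
      unfolding coset_norm_def by (auto dest!: cInf_lessD[rotated])
    obtain e' where e': "(0, e') \<in> S" "dist e' e < K + 1 - norm (y - e)"
      using e closure_approachable[of e "S `` {0}"]
      by (metis Image_singleton_iff diff_gt_0_iff_gt)
    have "norm (y - e') \<le> norm (y - e) + dist e' e"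
      using norm_triangle_ineq[of "y - e" "e - e'"] by (simp add: dist_norm norm_minus_commute)
    then have "norm (y - e') < K + 1" using e' by linarith
    moreover have "(u, y - e') \<in> S" using P.p.subspace_diff[OF sub y e'(1)] by simp
    ultimately show ?thesis by blast
  qed
  have "\<exists>w. (x, w) \<in> S \<and> norm w \<le> (K + 1) * norm x" if x: "x \<in> Domain S" for x
  proof (cases "x = 0")
    case True
    then show ?thesis using P.p.subspace_0[OF sub] by (auto simp: zero_prod_def)
  next
    case False
    obtain y where y: "(x, y) \<in> S" using x by blast
    let ?r = "of_real (norm x) :: 'k"
    have "(sX (inverse ?r) x, sY (inverse ?r) y) \<in> S"
      using P.p.subspace_scale[OF sub y, of "inverse ?r"] by (simp add: P.scale_def)
    moreover have "norm (sX (inverse ?r) x) \<le> 1"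
      using False by (simp add: X.norm_scale norm_inverse)
    ultimately obtain w where w: "(sX (inverse ?r) x, w) \<in> S" "norm w < K + 1"
      using unit by blast
    have "(x, sY ?r w) \<in> S"
      using P.p.subspace_scale[OF sub w(1), of ?r] False by (simp add: P.scale_def)
    moreover have "norm (sY ?r w) \<le> (K + 1) * norm x"
      using mult_right_mono[of "norm w" "K + 1" "norm x"] w(2)
      by (simp add: Y.norm_scale mult.commute)
    ultimately show ?thesis by blast
  qed
  then show thesis using that by blast
qed

section \<open>Sums and negatives of relations\<close>

lemma lr_addI: "(x, y) \<in> T \<Longrightarrow> (x, z) \<in> S \<Longrightarrow> (x, y + z) \<in> lr_add T S"
  unfolding lr_add_def by blast

lemma Domain_lr_add_Int: "Domain (lr_add T S) = Domain T \<inter> Domain S"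
  using lr_addI[of _ _ T _ S] by (fastforce simp: lr_add_def)

definition lr_uminus :: "('x \<times> 'y::uminus) set \<Rightarrow> ('x \<times> 'y) set"
  where "lr_uminus S = {(x, y). (x, - y) \<in> S}"

section \<open>The closure of a bounded perturbation\<close>

text \<open>
  Boundedness is expressed by images \<open>w\<close> rather than by \<^const>\<open>lr_norm\<close>, and linearity by
  closure under sums and differences, so that the hypotheses pass from the pair \<open>T\<close>, \<open>S\<close> to
  the pair \<open>T + S\<close>, \<open>-S\<close> with the same constant and without recomputing a norm. This makes
  the exchange of roles a mere second interpretation of the locale.
\<close>

locale bounded_perturbation =
  fixes T S :: "('x::real_normed_vector \<times> 'y::real_normed_vector) set" and C :: real
  assumes T_add: "\<And>p q. p \<in> T \<Longrightarrow> q \<in> T \<Longrightarrow> p + q \<in> T"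
    and S_zero: "0 \<in> S"
    and S_diff: "\<And>p q. p \<in> S \<Longrightarrow> q \<in> S \<Longrightarrow> p - q \<in> S"
    and closure_Domain: "closure (Domain T) \<subseteq> Domain S"
    and zero_image: "S `` {0} \<subseteq> T `` {0}"
    and image_bound: "\<And>x. x \<in> Domain S \<Longrightarrow> \<exists>w. (x, w) \<in> S \<and> norm w \<le> C * norm x"
begin

lemma S_uminus: "p \<in> S \<Longrightarrow> - p \<in> S"
  using S_diff[OF S_zero, of p] by simp

lemma S_add: "p \<in> S \<Longrightarrow> q \<in> S \<Longrightarrow> p + q \<in> S"
  using S_diff[OF _ S_uminus, of p q] by simp

lemma Domain_subset: "Domain T \<subseteq> Domain S"
  using closure_Domain closure_subset by blast

lemma Domain_lr_add: "Domain (lr_add T S) = Domain T"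
  using Domain_subset by (auto simp: Domain_lr_add_Int)

text \<open>
  Limits of domain points may leave the domain of \<open>T\<close>, but not that of \<open>S\<close>.
\<close>

lemma Domain_closure_subset:
  fixes R :: "('x \<times> 'y) set"
  assumes "Domain R \<subseteq> Domain T"
  shows "Domain (closure R) \<subseteq> Domain S"
proof
  fix x assume "x \<in> Domain (closure R)"
  then obtain y where "(x, y) \<in> closure R" by blast
  then obtain f where f: "\<And>n. f n \<in> R" "f \<longlonglongrightarrow> (x, y)"
    unfolding closure_sequential by blast
  have "fst (f n) \<in> Domain T" for n using f(1)[of n] assms by (metis Domain_fst image_eqI subsetD)
  moreover have "(\<lambda>n. fst (f n)) \<longlonglongrightarrow> x" using tendsto_fst[OF f(2)] by simp
  ultimately have "x \<in> closure (Domain T)"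
    unfolding closure_sequential by (intro exI[of _ "\<lambda>n. fst (f n)"]) simp
  then show "x \<in> Domain S" using closure_Domain by blast
qed

text \<open>
  Small images of \<open>x - a n\<close> are subtracted from a fixed image \<open>z\<close> of \<open>x\<close>, which gives images
  of \<open>a n\<close> that converge to \<open>z\<close>; arbitrary images of \<open>a n\<close> need not converge at all.
\<close>

lemma lr_add_closure_subset: "lr_add (closure T) S \<subseteq> closure (lr_add T S)"
proof
  fix p assume "p \<in> lr_add (closure T) S"
  then obtain x y z where p: "p = (x, y + z)" "(x, y) \<in> closure T" "(x, z) \<in> S"
    by (auto simp: lr_add_def)
  obtain f where f: "\<And>n. f n \<in> T" "f \<longlonglongrightarrow> (x, y)"
    using p(2) unfolding closure_sequential by blast
  define a b where "a n = fst (f n)" and "b n = snd (f n)" for n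
  have ab: "(a n, b n) \<in> T" for n using f(1) by (simp add: a_def b_def)
  have lim: "a \<longlonglongrightarrow> x" "b \<longlonglongrightarrow> y"
    using tendsto_fst[OF f(2)] tendsto_snd[OF f(2)] by (simp_all add: a_def[abs_def] b_def[abs_def])
  have "x - a n \<in> Domain S" for n
  proof -
    obtain v where "(a n, v) \<in> S" using ab[of n] Domain_subset by blast
    then show ?thesis using S_diff[OF p(3)] by fastforce
  qed
  then have "\<forall>n. \<exists>v. (x - a n, v) \<in> S \<and> norm v \<le> C * norm (x - a n)"
    using image_bound by blast
  then obtain w where w: "\<And>n. (x - a n, w n) \<in> S" "\<And>n. norm (w n) \<le> C * norm (x - a n)"
    by metis
  have "(\<lambda>n. C * norm (x - a n)) \<longlonglongrightarrow> C * norm (x - x)"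
    by (intro tendsto_intros lim)
  then have "w \<longlonglongrightarrow> 0"
    by (intro Lim_null_comparison[of w "\<lambda>n. C * norm (x - a n)"]) (use w(2) in simp_all)
  then have "(\<lambda>n. (a n, b n + (z - w n))) \<longlonglongrightarrow> (x, y + (z - 0))"
    by (intro tendsto_intros lim)
  moreover have "(a n, z - w n) \<in> S" for n using S_diff[OF p(3) w(1)[of n]] by simp
  then have "(a n, b n + (z - w n)) \<in> lr_add T S" for n using ab[of n] by (auto simp: lr_add_def)
  ultimately show "p \<in> closure (lr_add T S)"
    unfolding closure_sequential p(1) by (intro exI[of _ "\<lambda>n. (a n, b n + (z - w n))"]) simp
qed

lemma lr_add_uminus_cancel: "lr_add (lr_add T S) (lr_uminus S) = T"
proof
  show "lr_add (lr_add T S) (lr_uminus S) \<subseteq> T"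
  proof
    fix p assume "p \<in> lr_add (lr_add T S) (lr_uminus S)"
    then obtain x y z z' where p: "p = (x, y + z + z')" "(x, y) \<in> T" "(x, z) \<in> S" "(x, - z') \<in> S"
      by (auto simp: lr_add_def lr_uminus_def)
    have "(0, z + z') \<in> S" using S_diff[OF p(3,4)] by simp
    then have "(0, z + z') \<in> T" using zero_image by blast
    then show "p \<in> T" using T_add[OF p(2)] p(1) by (fastforce simp: add.assoc)
  qed
  show "T \<subseteq> lr_add (lr_add T S) (lr_uminus S)"
  proof
    fix p assume "p \<in> T"
    moreover obtain x y where p: "p = (x, y)" by fastforce
    ultimately obtain z where "(x, y) \<in> T" "(x, z) \<in> S" using Domain_subset by blast
    then have "(x, y + z) \<in> lr_add T S" "(x, - z) \<in> lr_uminus S"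
      by (auto simp: lr_add_def lr_uminus_def)
    then show "p \<in> lr_add (lr_add T S) (lr_uminus S)"
      unfolding p lr_add_def[of "lr_add T S"] by force
  qed
qed

lemma bounded_perturbation_uminus: "bounded_perturbation (lr_add T S) (lr_uminus S) C"
proof
  show "p + q \<in> lr_add T S" if pq: "p \<in> lr_add T S" "q \<in> lr_add T S" for p q
  proof -
    obtain x y z where p: "p = (x, y + z)" "(x, y) \<in> T" "(x, z) \<in> S"
      using pq(1) by (auto simp: lr_add_def)
    obtain x' y' z' where q: "q = (x', y' + z')" "(x', y') \<in> T" "(x', z') \<in> S"
      using pq(2) by (auto simp: lr_add_def)
    have "(x + x', y + y') \<in> T" "(x + x', z + z') \<in> S"
      using T_add[OF p(2) q(2)] S_add[OF p(3) q(3)] by simp_all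
    moreover have "p + q = (x + x', (y + y') + (z + z'))" by (simp add: p q algebra_simps)
    ultimately show ?thesis unfolding lr_add_def by blast
  qed
  show "0 \<in> lr_uminus S" using S_zero by (simp add: lr_uminus_def zero_prod_def)
  show "p - q \<in> lr_uminus S" if "p \<in> lr_uminus S" "q \<in> lr_uminus S" for p q
  proof -
    have "(fst p, - snd p) - (fst q, - snd q) \<in> S"
      using that by (intro S_diff) (auto simp: lr_uminus_def)
    then show ?thesis by (auto simp: lr_uminus_def case_prod_unfold)
  qed
  show "closure (Domain (lr_add T S)) \<subseteq> Domain (lr_uminus S)"
  proof -
    have "Domain S \<subseteq> Domain (lr_uminus S)"
      by (auto simp: lr_uminus_def Domain_unfold) (metis minus_minus)
    then show ?thesis using closure_Domain Domain_lr_add by auto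
  qed
  show "lr_uminus S `` {0} \<subseteq> lr_add T S `` {0}"
  proof
    fix z assume "z \<in> lr_uminus S `` {0}"
    then have "(0, z) \<in> S" using S_uminus[of "(0, - z)"] by (simp add: lr_uminus_def)
    then have "(0, z) \<in> T" using zero_image by blast
    moreover have "(0, 0) \<in> S" using S_zero by (simp add: zero_prod_def)
    ultimately show "z \<in> lr_add T S `` {0}" by (force simp: lr_add_def)
  qed
  show "\<exists>w. (x, w) \<in> lr_uminus S \<and> norm w \<le> C * norm x" if "x \<in> Domain (lr_uminus S)" for x
  proof -
    have "x \<in> Domain S" using that by (auto simp: lr_uminus_def)
    then obtain w where "(x, w) \<in> S" "norm w \<le> C * norm x" using image_bound by blast
    then show ?thesis by (intro exI[of _ "- w"]) (simp add: lr_uminus_def)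
  qed
qed

text \<open>
  One inclusion is the limit argument for \<open>T\<close>, \<open>S\<close>; the other is the limit argument for
  \<open>T + S\<close>, \<open>-S\<close>, with \<open>S\<close> added back.
\<close>

lemma closure_lr_add: "closure (lr_add T S) = lr_add (closure T) S"
proof
  show "lr_add (closure T) S \<subseteq> closure (lr_add T S)" by (rule lr_add_closure_subset)
  show "closure (lr_add T S) \<subseteq> lr_add (closure T) S"
  proof
    fix p assume p: "p \<in> closure (lr_add T S)"
    obtain x u where xu: "p = (x, u)" by fastforce
    obtain z where z: "(x, z) \<in> S"
      using Domain_closure_subset[of "lr_add T S"] Domain_lr_add p xu by blast
    interpret neg: bounded_perturbation "lr_add T S" "lr_uminus S" C
      by (rule bounded_perturbation_uminus)
    have "(x, u + - z) \<in> lr_add (closure (lr_add T S)) (lr_uminus S)"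
      using p z unfolding xu by (intro lr_addI) (simp_all add: lr_uminus_def)
    then have "(x, u - z) \<in> closure T"
      using neg.lr_add_closure_subset unfolding lr_add_uminus_cancel by auto
    then show "p \<in> lr_add (closure T) S"
      using lr_addI[OF _ z, of "u - z"] by (simp add: xu)
  qed
qed

lemma closed_lr_add: "closed T \<Longrightarrow> closed (lr_add T S)"
  using closure_lr_add by (simp add: closure_eq[symmetric] del: closure_eq)

lemma lr_closable_lr_add:
  assumes "lr_closable T"
  shows "lr_closable (lr_add T S)"
proof -
  have "closure (lr_add T S) `` {x} = lr_add T S `` {x}" if "x \<in> Domain (lr_add T S)" for x
  proof -
    have "closure T `` {x} = T `` {x}"
      using assms that unfolding Domain_lr_add by (simp add: lr_closable_def)
    then have "(x, y) \<in> closure T \<longleftrightarrow> (x, y) \<in> T" for y by blast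
    then show ?thesis unfolding closure_lr_add by (auto simp: lr_add_def)
  qed
  then show ?thesis by (simp add: lr_closable_def)
qed

lemma Domain_closure_lr_add: "Domain (closure (lr_add T S)) = Domain (closure T)"
  unfolding closure_lr_add using Domain_closure_subset[of T] by (auto simp: Domain_lr_add_Int)

end

section \<open>Closedness, closability and the domain of the closure\<close>

theorem theorem6p4:
  fixes sX :: "'k::real_normed_field \<Rightarrow> 'x::real_normed_vector \<Rightarrow> 'x"
    and sY :: "'k \<Rightarrow> 'y::real_normed_vector \<Rightarrow> 'y"
    and T S :: "('x \<times> 'y) set"
  assumes "normed_space sX" and "normed_space sY"
    and "T \<in> LR sX sY" and "S \<in> LR sX sY"
    and "closure (Domain T) \<subseteq> Domain S"
    and "S `` {0} \<subseteq> T `` {0}"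
    and "lr_bounded S"
  shows "(closed (lr_add T S) \<longleftrightarrow> closed T)
    \<and> (lr_closable (lr_add T S) \<longleftrightarrow> lr_closable T)
    \<and> Domain (closure (lr_add T S)) = Domain (closure T)"
proof -
  interpret X: normed_space sX by fact
  interpret Y: normed_space sY by fact
  interpret P: vector_space_prod sX sY by unfold_locales
  have sub: "P.p.subspace T" "P.p.subspace S" using assms(3,4) by (simp_all add: LR_def)
  obtain C where C: "\<And>x. x \<in> Domain S \<Longrightarrow> \<exists>w. (x, w) \<in> S \<and> norm w \<le> C * norm x"
    using lr_bounded_image_bound[OF assms(1,2,4,7)] by blast
  interpret pos: bounded_perturbation T S C
    by unfold_locales
      (use assms(5,6) C sub in \<open>auto intro: P.p.subspace_add P.p.subspace_0 P.p.subspace_diff\<close>)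
  interpret neg: bounded_perturbation "lr_add T S" "lr_uminus S" C
    by (rule pos.bounded_perturbation_uminus)
  show ?thesis
    using pos.closed_lr_add neg.closed_lr_add pos.lr_closable_lr_add neg.lr_closable_lr_add
      pos.Domain_closure_lr_add
    unfolding pos.lr_add_uminus_cancel by blast
qed

end
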